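(* Let $F(x)=\sum_{n\geqslant 0}|\mathcal{I}_n(102,210)|\,x^n$. Then $$F(x)=\frac{(4x-1)(4x^4-22x^3+25x^2-9x+1)-(2x-1)(x^2-5x+1)(2x^2-4x+1)\sqrt{1-4x}}{2x^3(4x-1)(x-1)^2},$$ where $\sqrt{1-4x}$ denotes the formal power series square root with constant term $1$.
   Context: For $n\in\mathbb N$, an inversion sequence of size $n$ is a sequence $\sigma=(\sigma_1,\dots,\sigma_n)\in\mathbb N^n$ with $\sigma_i<i$ for all $i$ (there is one, empty, inversion sequence of size $0$). An integer sequence contains a pattern $\rho$ (a finite integer sequence such as $102$ or $210$) if it has a subsequence order-isomorphic to $\rho$, and avoids $\rho$ otherwise. $\mathcal{I}_n(P)$ denotes the set of inversion sequences of size $n$ avoiding every pattern in $P$. *)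

theory Defs
  imports
    Complex_Main
    "HOL-Library.Sublist"
    "HOL-Computational_Algebra.Formal_Laurent_Series"
begin

text \<open>Two words are order-isomorphic if their entries compare in the same way. Since \<open>i\<close> and \<open>j\<close>
  range over all ordered pairs of positions, equal entries have to correspond to equal entries.\<close>

definition order_isomorphic :: "'a::linorder list \<Rightarrow> 'b::linorder list \<Rightarrow> bool" where
  "order_isomorphic xs ys \<longleftrightarrow>
     length xs = length ys \<and>
     (\<forall>i < length xs. \<forall>j < length xs. xs ! i < xs ! j \<longleftrightarrow> ys ! i < ys ! j)"

definition contains_pattern :: "'a::linorder list \<Rightarrow> 'b::linorder list \<Rightarrow> bool" where
  "contains_pattern \<sigma> \<rho> \<longleftrightarrow> (\<exists>\<tau>. subseq \<tau> \<sigma> \<and> order_isomorphic \<tau> \<rho>)"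

text \<open>Lists are indexed from 0, so the usual condition \<open>\<sigma>\<^sub>i < i\<close> for \<open>1 \<le> i \<le> n\<close> becomes
  \<open>\<sigma> ! i < Suc i\<close> for \<open>i < n\<close>.\<close>

definition inversion_sequence :: "nat list \<Rightarrow> bool" where
  "inversion_sequence \<sigma> \<longleftrightarrow> (\<forall>i < length \<sigma>. \<sigma> ! i < Suc i)"

definition avoiding_inversion_sequences :: "nat \<Rightarrow> int list set \<Rightarrow> nat list set" where
  "avoiding_inversion_sequences n P =
     {\<sigma>. length \<sigma> = n \<and> inversion_sequence \<sigma> \<and> (\<forall>\<rho> \<in> P. \<not> contains_pattern \<sigma> \<rho>)}"

lemma finite_avoiding_inversion_sequences: "finite (avoiding_inversion_sequences n P)"
proof (rule finite_subset)
  show "avoiding_inversion_sequences n P \<subseteq> {\<sigma>. set \<sigma> \<subseteq> {..n} \<and> length \<sigma> = n}"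
  proof
    fix \<sigma> assume "\<sigma> \<in> avoiding_inversion_sequences n P"
    then have len: "length \<sigma> = n" and inv: "\<forall>i < n. \<sigma> ! i < Suc i"
      by (auto simp: avoiding_inversion_sequences_def inversion_sequence_def)
    have "x \<le> n" if "x \<in> set \<sigma>" for x
    proof -
      from that len obtain i where "i < n" "x = \<sigma> ! i" by (metis in_set_conv_nth)
      with inv show ?thesis by fastforce
    qed
    with len show "\<sigma> \<in> {\<sigma>. set \<sigma> \<subseteq> {..n} \<and> length \<sigma> = n}" by auto
  qed
  show "finite {\<sigma>. set \<sigma> \<subseteq> {..n} \<and> length \<sigma> = n}"
    by (rule finite_lists_length_eq) simp
qed

text \<open>The square root of \<open>1 - 4x\<close> with constant term 1.\<close>

definition sqrt_one_minus_4X :: "real fps" where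
  "sqrt_one_minus_4X = fps_radical root 2 (1 - 4 * fps_X)"

lemma sqrt_one_minus_4X_nth_0: "fps_nth sqrt_one_minus_4X 0 = 1"
  by (simp add: sqrt_one_minus_4X_def)

lemma sqrt_one_minus_4X_power2: "sqrt_one_minus_4X ^ 2 = 1 - 4 * fps_X"
  using power_radical[of "1 - 4 * fps_X :: real fps" root 1]
  by (simp add: sqrt_one_minus_4X_def numeral_2_eq_2)

end

theory Submission
  imports Defs
begin

text \<open>Read an avoiding inversion sequence up to its first descent, from a value \<open>m\<close> to a value \<open>v\<close>.
  The prefix \<open>\<alpha>\<close> before the descent is weakly increasing. Avoiding 102 makes \<open>m\<close> the overall maximum
  and keeps everything after \<open>v\<close> at or below the successor of \<open>v\<close> among the values of \<open>\<alpha>\<close>; avoiding 210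
  makes the later entries other than \<open>m\<close> increase weakly from \<open>v\<close>. So the number of completions of
  \<open>\<alpha>\<close> depends linearly on two statistics of the gaps between the values of \<open>\<alpha>\<close>, with coefficients
  depending only on the slack \<open>length \<alpha> - last \<alpha>\<close>. The resulting recursion in the slack is solved by
  the kernel method, with the Catalan series as root of the kernel.\<close>

section \<open>Avoidance\<close>

text \<open>The first conjunct excludes 102, the second 210; together, after a drop
  \<open>b < a\<close> the third entry lies in \<open>{b..a}\<close>.\<close>

definition good3 :: "'a::linorder \<Rightarrow> 'a \<Rightarrow> 'a \<Rightarrow> bool" where
  "good3 a b c \<longleftrightarrow> \<not> (b < a \<and> a < c) \<and> \<not> (b < a \<and> c < b)"

primrec avoids :: "'a::linorder list \<Rightarrow> bool" where
  "avoids [] \<longleftrightarrow> True"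
| "avoids (x # xs) \<longleftrightarrow> sorted_wrt (good3 x) xs \<and> avoids xs"

lemma subseq_pair_Cons:
  "subseq [a, b] (x # xs) \<longleftrightarrow> a = x \<and> b \<in> set xs \<or> subseq [a, b] xs"
  by (auto simp: subseq_singleton_left dest: subseq_Cons')

lemma sorted_wrt_iff_subseq: "sorted_wrt P xs \<longleftrightarrow> (\<forall>a b. subseq [a, b] xs \<longrightarrow> P a b)"
proof (induction xs)
  case (Cons x xs)
  then show ?case unfolding subseq_pair_Cons by auto
qed auto

lemma avoids_iff_subseq:
  "avoids xs \<longleftrightarrow> (\<forall>a b c. subseq [a, b, c] xs \<longrightarrow> good3 a b c)"
proof (induction xs)
  case (Cons x xs)
  have *: "subseq [a, b, c] (x # xs) \<longleftrightarrow> a = x \<and> subseq [b, c] xs \<or> subseq [a, b, c] xs" for a b c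
    by (auto dest: subseq_Cons')
  show ?case unfolding * by (auto simp: Cons sorted_wrt_iff_subseq)
qed auto

lemma length_3_exE: "length xs = 3 \<Longrightarrow> \<exists>a b c. xs = [a, b, c]"
  by (auto simp: numeral_3_eq_3 length_Suc_conv)

lemma order_isomorphic_102:
  "order_isomorphic \<tau> [1, 0, 2 :: int] \<longleftrightarrow> (\<exists>a b c. \<tau> = [a, b, c] \<and> b < a \<and> a < c)"
proof
  assume l: "order_isomorphic \<tau> [1, 0, 2 :: int]"
  then have "length \<tau> = 3" by (simp add: order_isomorphic_def)
  then obtain a b c where "\<tau> = [a, b, c]" using length_3_exE by blast
  with l show "\<exists>a b c. \<tau> = [a, b, c] \<and> b < a \<and> a < c"
    by (auto simp: order_isomorphic_def All_less_Suc numeral_3_eq_3 less_Suc_eq)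
next
  assume "\<exists>a b c. \<tau> = [a, b, c] \<and> b < a \<and> a < c"
  then show "order_isomorphic \<tau> [1, 0, 2 :: int]"
    by (auto simp: order_isomorphic_def All_less_Suc less_Suc_eq)
qed

lemma order_isomorphic_210:
  "order_isomorphic \<tau> [2, 1, 0 :: int] \<longleftrightarrow> (\<exists>a b c. \<tau> = [a, b, c] \<and> b < a \<and> c < b)"
proof
  assume l: "order_isomorphic \<tau> [2, 1, 0 :: int]"
  then have "length \<tau> = 3" by (simp add: order_isomorphic_def)
  then obtain a b c where "\<tau> = [a, b, c]" using length_3_exE by blast
  with l show "\<exists>a b c. \<tau> = [a, b, c] \<and> b < a \<and> c < b"
    by (auto simp: order_isomorphic_def All_less_Suc numeral_3_eq_3 less_Suc_eq)
next
  assume "\<exists>a b c. \<tau> = [a, b, c] \<and> b < a \<and> c < b"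
  then show "order_isomorphic \<tau> [2, 1, 0 :: int]"
    by (auto simp: order_isomorphic_def All_less_Suc less_Suc_eq)
qed

lemma avoids_iff_not_contains:
  "avoids \<sigma> \<longleftrightarrow> \<not> contains_pattern \<sigma> [1, 0, 2 :: int] \<and> \<not> contains_pattern \<sigma> [2, 1, 0 :: int]"
  unfolding avoids_iff_subseq contains_pattern_def order_isomorphic_102 order_isomorphic_210 good3_def
  by blast

definition valid :: "nat list \<Rightarrow> bool" where
  "valid \<sigma> \<longleftrightarrow> inversion_sequence \<sigma> \<and> avoids \<sigma>"

lemma avoiding_inversion_sequences_eq:
  "avoiding_inversion_sequences n {[1, 0, 2], [2, 1, 0]} = {\<sigma>. length \<sigma> = n \<and> valid \<sigma>}"
  by (auto simp: avoiding_inversion_sequences_def valid_def avoids_iff_not_contains)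

lemma avoids_append:
  "avoids (xs @ ys) \<longleftrightarrow> avoids xs \<and> avoids ys \<and> (\<forall>x \<in> set xs. sorted_wrt (good3 x) ys) \<and>
     (\<forall>y \<in> set ys. sorted_wrt (\<lambda>a b. good3 a b y) xs)"
  by (induction xs) (auto simp: sorted_wrt_append)

lemma sorted_imp_sorted_wrt_good3: "sorted xs \<Longrightarrow> sorted_wrt (\<lambda>a b. good3 a b y) xs"
  by (erule sorted_wrt_mono_rel[rotated]) (auto simp: good3_def)

lemma sorted_imp_avoids: "sorted xs \<Longrightarrow> avoids xs"
proof (induction xs)
  case (Cons x xs)
  have "sorted_wrt (good3 x) xs"
  proof (rule sorted_wrt_mono_rel[of xs "(\<le>)"])
    fix y z assume "y \<in> set xs"
    with Cons.prems have "x \<le> y" by simp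
    then show "good3 x y z" by (auto simp: good3_def)
  qed (use Cons.prems in simp)
  with Cons show ?case by simp
qed auto

lemma inversion_sequence_append:
  "inversion_sequence (xs @ ys) \<longleftrightarrow>
     inversion_sequence xs \<and> (\<forall>i < length ys. ys ! i \<le> length xs + i)"
proof
  assume l: "inversion_sequence (xs @ ys)"
  have "xs ! i < Suc i" if "i < length xs" for i
    using l that unfolding inversion_sequence_def
    by (metis length_append nth_append trans_less_add1)
  moreover have "ys ! i \<le> length xs + i" if "i < length ys" for i
  proof -
    have "(xs @ ys) ! (length xs + i) < Suc (length xs + i)"
      using l that unfolding inversion_sequence_def by (metis length_append nat_add_left_cancel_less)
    then show ?thesis by simp
  qed
  ultimately show "inversion_sequence xs \<and> (\<forall>i < length ys. ys ! i \<le> length xs + i)"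
    by (auto simp: inversion_sequence_def)
next
  assume r: "inversion_sequence xs \<and> (\<forall>i < length ys. ys ! i \<le> length xs + i)"
  show "inversion_sequence (xs @ ys)" unfolding inversion_sequence_def
  proof (intro allI impI)
    fix i assume i: "i < length (xs @ ys)"
    show "(xs @ ys) ! i < Suc i"
    proof (cases "i < length xs")
      case True
      with r show ?thesis by (simp add: nth_append inversion_sequence_def)
    next
      case False
      then have "i - length xs < length ys" using i by simp
      with r have "ys ! (i - length xs) \<le> length xs + (i - length xs)" by blast
      with False show ?thesis by (simp add: nth_append)
    qed
  qed
qed

section \<open>Ascending prefixes\<close>

definition ascending :: "nat list \<Rightarrow> bool" where
  "ascending \<alpha> \<longleftrightarrow> sorted \<alpha> \<and> \<alpha> \<noteq> [] \<and> inversion_sequence \<alpha>"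

definition succ_in :: "nat list \<Rightarrow> nat \<Rightarrow> nat" where
  "succ_in \<alpha> v = Min {b \<in> set \<alpha>. v < b}"

lemma ascending_last: "ascending \<alpha> \<Longrightarrow> last \<alpha> < length \<alpha>"
  unfolding ascending_def inversion_sequence_def
  by (metis One_nat_def Suc_pred diff_less last_conv_nth length_greater_0_conv zero_less_one)

lemma sorted_le_last: "sorted \<alpha> \<Longrightarrow> x \<in> set \<alpha> \<Longrightarrow> x \<le> last \<alpha>"
  by (induction \<alpha>) auto

lemma ascending_snoc:
  assumes "ascending \<alpha>" "last \<alpha> \<le> v" "v \<le> length \<alpha>"
  shows "ascending (\<alpha> @ [v])"
  using assms sorted_le_last[of \<alpha>]
  by (fastforce simp: ascending_def sorted_append inversion_sequence_append)

lemma ascending_valid: "ascending \<alpha> \<Longrightarrow> valid \<alpha>"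
  by (simp add: ascending_def valid_def sorted_imp_avoids)

lemma succ_in:
  assumes "\<alpha> \<noteq> []" "v < last \<alpha>"
  shows "succ_in \<alpha> v \<in> set \<alpha>" "v < succ_in \<alpha> v"
proof -
  have "{b \<in> set \<alpha>. v < b} \<noteq> {}" using assms last_in_set by blast
  then have "succ_in \<alpha> v \<in> {b \<in> set \<alpha>. v < b}" unfolding succ_in_def by (intro Min_in) auto
  then show "succ_in \<alpha> v \<in> set \<alpha>" "v < succ_in \<alpha> v" by auto
qed

lemma succ_in_le: "b \<in> set \<alpha> \<Longrightarrow> v < b \<Longrightarrow> succ_in \<alpha> v \<le> b"
  unfolding succ_in_def by (intro Min_le) auto

text \<open>A new maximum leaves the old gaps alone and opens at most one new gap, so sums over gaps
  are additive under extension.\<close>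

lemma succ_in_snoc:
  assumes "sorted \<alpha>" "\<alpha> \<noteq> []" "last \<alpha> \<le> v" "w < v"
  shows "succ_in (\<alpha> @ [v]) w = (if w < last \<alpha> then succ_in \<alpha> w else v)"
proof (cases "w < last \<alpha>")
  case True
  then have "succ_in \<alpha> w \<le> last \<alpha>" using assms by (intro succ_in_le) auto
  then have "succ_in \<alpha> w \<le> v" using assms by simp
  then have "Min {b \<in> set (\<alpha> @ [v]). w < b} = succ_in \<alpha> w"
    using True assms succ_in[OF assms(2) True] succ_in_le[of _ \<alpha> w] by (intro Min_eqI) auto
  with True show ?thesis by (simp add: succ_in_def)
next
  case False
  then have "{b \<in> set (\<alpha> @ [v]). w < b} = {v}"
    using assms sorted_le_last[of \<alpha>] by fastforce
  with False show ?thesis by (simp add: succ_in_def)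
qed

text \<open>The words that may follow the first descent, from \<open>m\<close> to \<open>v\<close>, when the letter \<open>b\<close> is the
  successor of \<open>v\<close> in the prefix; the letter \<open>m\<close> itself occurs only if \<open>b = m\<close>.\<close>

definition word :: "nat \<Rightarrow> nat \<Rightarrow> nat \<Rightarrow> nat list \<Rightarrow> bool" where
  "word m b v \<tau> \<longleftrightarrow> set \<tau> \<subseteq> {v..b} \<and> sorted_wrt (\<lambda>x y. x < m \<longrightarrow> x \<le> y) \<tau>"

lemma word_Cons: "word m b v (w # \<tau>) \<longleftrightarrow> w \<in> {v..b} \<and> word m b (if w < m then w else v) \<tau>"
  by (auto simp: word_def)

text \<open>Only \<open>m\<close> can start a drop. No letter exceeds \<open>m\<close>, which
  excludes 102, and the lower letter of a drop is below \<open>m\<close>, which excludes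
  210.\<close>

lemma avoids_word:
  assumes "set \<tau> \<subseteq> {..m}" "sorted_wrt (\<lambda>x y. x < m \<longrightarrow> x \<le> y) \<tau>"
  shows "avoids \<tau>"
  using assms
proof (induction \<tau>)
  case (Cons t \<tau>)
  have "sorted_wrt (good3 t) \<tau>"
  proof (rule sorted_wrt_mono_rel)
    show "sorted_wrt (\<lambda>x y. x < m \<longrightarrow> x \<le> y) \<tau>" using Cons.prems by simp
    fix x y assume "x \<in> set \<tau>" "y \<in> set \<tau>" "x < m \<longrightarrow> x \<le> y"
    moreover from this have "t \<le> m" "y \<le> m" "t < m \<longrightarrow> t \<le> x" using Cons.prems by auto
    ultimately show "good3 t x y" by (auto simp: good3_def)
  qed
  with Cons show ?case by simp
qed auto

text \<open>The drop from \<open>m\<close> to \<open>v\<close> forbids letters below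
  \<open>v\<close>, the drop from \<open>b\<close> to \<open>v\<close> forbids letters above
  \<open>b\<close>, and \<open>m\<close> with two later letters gives the order condition. Nothing
  else is forced, as no value of \<open>\<alpha>\<close> lies strictly between \<open>v\<close> and
  \<open>b\<close>.\<close>

lemma valid_descent:
  assumes \<alpha>: "ascending \<alpha>" and v: "v < last \<alpha>"
  shows "valid (\<alpha> @ v # \<tau>) \<longleftrightarrow> word (last \<alpha>) (succ_in \<alpha> v) v \<tau>"
proof -
  define m where "m = last \<alpha>"
  define b where "b = succ_in \<alpha> v"
  have s: "sorted \<alpha>" "\<alpha> \<noteq> []" using \<alpha> by (auto simp: ascending_def)
  have m: "m \<in> set \<alpha>" "v < m" using s v by (auto simp: m_def)
  have b: "b \<in> set \<alpha>" "v < b" "b \<le> m" using succ_in[of \<alpha> v] s v m succ_in_le by (auto simp: m_def b_def)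
  show ?thesis unfolding m_def[symmetric] b_def[symmetric]
  proof
    assume "valid (\<alpha> @ v # \<tau>)"
    then have *: "sorted_wrt (good3 x) (v # \<tau>)" if "x \<in> set \<alpha>" for x
      using that by (auto simp: valid_def avoids_append)
    have "sorted_wrt (\<lambda>x y. x < m \<longrightarrow> x \<le> y) \<tau>"
      using *[OF m(1)] by (auto simp: good3_def elim!: sorted_wrt_mono_rel[rotated])
    moreover have "t \<in> {v..b}" if "t \<in> set \<tau>" for t
    proof -
      have "good3 m v t" "good3 b v t" using *[OF m(1)] *[OF b(1)] that by auto
      with m b show ?thesis by (auto simp: good3_def)
    qed
    ultimately show "word m b v \<tau>" by (auto simp: word_def)
  next
    assume w: "word m b v \<tau>"
    then have w1: "v \<le> t" "t \<le> b" if "t \<in> set \<tau>" for t using that by (auto simp: word_def)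
    have w2: "sorted_wrt (\<lambda>x y. x < m \<longrightarrow> x \<le> y) \<tau>" using w by (simp add: word_def)
    have xm: "x \<le> m" if "x \<in> set \<alpha>" for x using sorted_le_last s that by (auto simp: m_def)
    have xb: "b \<le> x" if "x \<in> set \<alpha>" "v < x" for x using succ_in_le that by (auto simp: b_def)
    have "avoids \<tau>" using w1 b by (intro avoids_word[OF _ w2]) fastforce
    moreover have "sorted_wrt (good3 v) \<tau>"
    proof (rule sorted_wrt_mono_rel[OF _ w2])
      fix x y assume "x \<in> set \<tau>" "y \<in> set \<tau>" "x < m \<longrightarrow> x \<le> y"
      with w1 show "good3 v x y" by (fastforce simp: good3_def)
    qed
    moreover have "good3 x v t" if "x \<in> set \<alpha>" "t \<in> set \<tau>" for x t
      using w1[OF that(2)] xb[OF that(1)] by (fastforce simp: good3_def)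
    \<comment> \<open>If \<open>x \<le> v\<close>, no letter of \<open>\<tau>\<close> is below
      \<open>x\<close>. If \<open>b \<le> x\<close>, none exceeds \<open>x\<close>, and
      \<open>t < x\<close> forces \<open>t < m\<close>, so nothing smaller follows
      \<open>t\<close>.\<close>
    moreover have "sorted_wrt (good3 x) \<tau>" if "x \<in> set \<alpha>" for x
    proof (rule sorted_wrt_mono_rel[OF _ w2])
      fix t t' assume "t \<in> set \<tau>" "t' \<in> set \<tau>" "t < m \<longrightarrow> t \<le> t'"
      with w1[of t] w1[of t'] xb[OF that] xm[OF that] show "good3 x t t'" by (fastforce simp: good3_def)
    qed
    \<comment> \<open>The size bounds are automatic: all later letters are at most
      \<open>m < length \<alpha>\<close>.\<close>
    moreover have "inversion_sequence (\<alpha> @ v # \<tau>)"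
    proof -
      have "m < length \<alpha>" using ascending_last \<alpha> by (simp add: m_def)
      then have "t \<le> length \<alpha>" if "t \<in> set (v # \<tau>)" for t using that w1 b by fastforce
      then have "(v # \<tau>) ! i \<le> length \<alpha> + i" if "i < length (v # \<tau>)" for i
        using that nth_mem trans_le_add1 by blast
      with \<alpha> show ?thesis by (auto simp: inversion_sequence_append ascending_def)
    qed
    ultimately show "valid (\<alpha> @ v # \<tau>)"
      using s by (auto simp: valid_def avoids_append sorted_imp_avoids sorted_imp_sorted_wrt_good3)
  qed
qed

section \<open>Generating functions of sets of words\<close>

definition gf :: "(nat list \<Rightarrow> bool) \<Rightarrow> real fps" where
  "gf Q = Abs_fps (\<lambda>n. real (card {\<tau>. length \<tau> = n \<and> Q \<tau>}))"

text \<open>Splits by the first letter; \<open>fin\<close> rules out infinite sets, where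
  \<open>card\<close> defaults to 0.\<close>

lemma gf_Cons:
  assumes V: "finite V" "\<And>v \<tau>. Q (v # \<tau>) \<Longrightarrow> v \<in> V"
    and fin: "\<And>n. finite {\<tau>. length \<tau> = n \<and> Q \<tau>}"
  shows "gf Q = (if Q [] then 1 else 0) + fps_X * (\<Sum>v\<in>V. gf (\<lambda>\<tau>. Q (v # \<tau>)))"
proof (rule fps_ext)
  fix n
  show "gf Q $ n = ((if Q [] then 1 else 0) + fps_X * (\<Sum>v\<in>V. gf (\<lambda>\<tau>. Q (v # \<tau>)))) $ n"
  proof (cases n)
    case 0
    have "{\<tau>. \<tau> = [] \<and> Q \<tau>} = (if Q [] then {[]} else {})" by auto
    with 0 show ?thesis by (simp add: gf_def)
  next
    case (Suc k)
    define T where "T v = {\<tau>. length \<tau> = k \<and> Q (v # \<tau>)}" for v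
    have "{\<tau>. length \<tau> = n \<and> Q \<tau>} = (\<Union>v\<in>V. (#) v ` T v)"
      using V(2) by (auto simp: Suc T_def length_Suc_conv image_iff)
    moreover have "finite (T v)" for v
    proof -
      have "(#) v ` T v \<subseteq> {\<tau>. length \<tau> = n \<and> Q \<tau>}" by (auto simp: T_def Suc)
      then show ?thesis using fin[of n] finite_subset by (metis finite_imageD inj_on_Cons1)
    qed
    ultimately have "card {\<tau>. length \<tau> = n \<and> Q \<tau>} = (\<Sum>v\<in>V. card ((#) v ` T v))"
      using V(1) by (subst card_UN_disjoint[symmetric]) auto
    also have "\<dots> = (\<Sum>v\<in>V. card (T v))" by (simp add: card_image)
    finally show ?thesis by (simp add: gf_def Suc fps_sum_nth T_def)
  qed
qed

text \<open>Because of the factor \<open>fps_X\<close>, coefficient \<open>n\<close> depends on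
  lower coefficients only, so all vanish by induction. Applied to differences, this gives uniqueness
  of solutions.\<close>

lemma fps_contraction_unique:
  fixes \<Delta> :: "'i \<Rightarrow> 'a::comm_ring_1 fps"
  assumes "\<And>i. i \<in> S \<Longrightarrow> J i \<subseteq> S"
    and "\<And>i. i \<in> S \<Longrightarrow> \<Delta> i = fps_X * (\<Sum>j\<in>J i. q i * \<Delta> j)"
    and "i \<in> S"
  shows "\<Delta> i = 0"
proof -
  have "\<forall>i\<in>S. \<Delta> i $ n = 0" for n
  proof (induction n rule: less_induct)
    case (less n)
    show ?case
    proof
      fix i assume i: "i \<in> S"
      show "\<Delta> i $ n = 0"
      proof (cases n)
        case 0
        then show ?thesis by (subst assms(2)[OF i]) simp
      next
        case (Suc k)
        have "(q i * \<Delta> j) $ k = 0" if "j \<in> J i" for j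
          using less assms(1)[OF i] that Suc by (auto simp: fps_mult_nth intro!: sum.neutral)
        then show ?thesis by (subst assms(2)[OF i]) (simp add: Suc fps_sum_nth)
      qed
    qed
  qed
  with assms(3) show ?thesis by (intro fps_ext) simp
qed

section \<open>The geometric series and the Catalan series\<close>

definition geom :: "real fps" where "geom = inverse (1 - fps_X)"

text \<open>Equals 1 + x/(1 - 2x), counting the empty word and the words over two letters that start
  with a prescribed one.\<close>

definition bigeom :: "real fps" where "bigeom = (1 - fps_X) * inverse (1 - 2 * fps_X)"

text \<open>The series (1 - sqrt(1 - 4x))/(2x); the shift divides exactly by x, the numerator having
  constant term 0.\<close>

definition catalan :: "real fps" where
  "catalan = fps_const (1/2) * fps_shift 1 (1 - sqrt_one_minus_4X)"

lemma geom: "geom * (1 - fps_X) = 1" "geom = 1 + fps_X * geom"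
proof -
  show "geom * (1 - fps_X) = 1" by (simp add: geom_def inverse_mult_eq_1)
  then show "geom = 1 + fps_X * geom" by (simp add: algebra_simps)
qed

lemma bigeom: "(1 - 2 * fps_X) * bigeom = 1 - fps_X"
proof -
  have "inverse (1 - 2 * fps_X) * (1 - 2 * fps_X :: real fps) = 1"
    by (rule inverse_mult_eq_1) (simp add: numeral_fps_const)
  then show ?thesis unfolding bigeom_def by algebra
qed

lemma bigeom_diff_1: "fps_X * geom * bigeom = bigeom - 1"
proof -
  have "fps_X * geom * bigeom = geom * (1 - fps_X) * (bigeom - 1)"
    using bigeom by algebra
  then show ?thesis by (simp add: geom(1))
qed

lemma sqrt_eq_catalan: "sqrt_one_minus_4X = 1 - 2 * fps_X * catalan"
proof -
  have "fps_X * fps_shift 1 (1 - sqrt_one_minus_4X) = 1 - sqrt_one_minus_4X"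
    by (intro fps_ext) (simp add: sqrt_one_minus_4X_nth_0)
  then have "2 * fps_X * catalan = 1 - sqrt_one_minus_4X"
    by (simp add: catalan_def mult.left_commute numeral_fps_const mult.assoc)
  then show ?thesis by simp
qed

lemma catalan: "fps_X * catalan\<^sup>2 = catalan - 1"
proof -
  have "(4 * fps_X) * (fps_X * catalan\<^sup>2) = 4 * fps_X * (catalan - 1)"
    using sqrt_one_minus_4X_power2 unfolding sqrt_eq_catalan by algebra
  then show ?thesis by (simp add: mult_cancel_left)
qed

lemma catalan_nth_0: "catalan $ 0 = 1"
proof -
  have "(fps_X * catalan\<^sup>2) $ 0 = (catalan - 1) $ 0" by (simp only: catalan)
  then show ?thesis by simp
qed

text \<open>The denominator of the geometric sum in \<open>catalan_geom_sum\<close>. Times 1 - x it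
  reads c - 1 - xc = xc(c - 1) = x^2 c^3 for the Catalan series c.\<close>

lemma catalan_diff_geom: "catalan - geom = fps_X\<^sup>2 * catalan ^ 3 * geom"
  using catalan geom(2) by algebra

section \<open>Counting the words after the first descent\<close>

lemma finite_word: "finite {\<tau>. length \<tau> = n \<and> word m b v \<tau>}"
  by (rule finite_subset[OF _ finite_lists_length_eq[of "{v..b}" n]]) (auto simp: word_def)

lemma gf_word_rec:
  "gf (word m b v) = 1 + fps_X * (\<Sum>w\<in>{v..b}. gf (word m b (if w < m then w else v)))"
proof -
  have "gf (word m b v) = (if word m b v [] then 1 else 0) +
      fps_X * (\<Sum>w\<in>{v..b}. gf (\<lambda>\<tau>. word m b v (w # \<tau>)))"
    by (rule gf_Cons) (auto simp: word_Cons finite_word)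
  also have "(\<Sum>w\<in>{v..b}. gf (\<lambda>\<tau>. word m b v (w # \<tau>))) =
      (\<Sum>w\<in>{v..b}. gf (word m b (if w < m then w else v)))"
    by (rule sum.cong) (auto simp: word_Cons)
  finally show ?thesis by (simp add: word_def[of m b v "[]"])
qed

lemma geom_cancel: "a * (1 - fps_X) = b \<Longrightarrow> a = geom * b"
  using geom(1) by (metis mult.commute mult.left_commute mult.right_neutral)

text \<open>The letter \<open>m\<close> cannot occur, so the word increases weakly: each of the
  \<open>Suc b - v\<close> values forms a block of arbitrary length, with series
  \<open>geom\<close>.\<close>

lemma gf_word_less:
  assumes "v \<le> b" "b < m"
  shows "gf (word m b v) = geom ^ (Suc b - v)"
  using assms(1)
proof (induction rule: inc_induct)
  case base
  have "gf (word m b b) = 1 + fps_X * gf (word m b b)"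
    using gf_word_rec[of m b b] assms by simp
  then have "gf (word m b b) = geom * 1" by (intro geom_cancel) (simp add: algebra_simps)
  then show ?case by simp
next
  case (step v)
  have "gf (word m b v') = 1 + fps_X * (\<Sum>w\<in>{v'..b}. gf (word m b w))" for v'
    by (subst gf_word_rec) (use assms in \<open>auto intro!: sum.cong\<close>)
  from this[of v] this[of "Suc v"] have "gf (word m b v) * (1 - fps_X) = gf (word m b (Suc v))"
    using step by (simp add: sum.atLeast_Suc_atMost[of v b] algebra_simps)
  from geom_cancel[OF this] show ?case using step by (simp add: Suc_diff_le)
qed

text \<open>Such a word is a run of letters \<open>m\<close> followed, for each \<open>i\<close> in
  \<open>{v..<m}\<close> in turn, by nothing or by a word over \<open>i\<close> and \<open>m\<close>
  starting with \<open>i\<close>. These pieces have series \<open>geom\<close> and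
  \<open>bigeom\<close>.\<close>

lemma gf_word_eq:
  assumes "v \<le> m"
  shows "gf (word m m v) = geom * bigeom ^ (m - v)"
  using assms
proof (induction rule: inc_induct)
  case base
  have "gf (word m m m) = 1 + fps_X * gf (word m m m)"
    using gf_word_rec[of m m m] by simp
  then have "gf (word m m m) = geom * 1" by (intro geom_cancel) (simp add: algebra_simps)
  then show ?case by simp
next
  case (step v)
  have *: "gf (word m m v') = 1 + fps_X * (\<Sum>w\<in>{v'..<m}. gf (word m m w)) + fps_X * gf (word m m v')"
    if "v' \<le> m" for v'
  proof -
    have "{v'..m} = insert m {v'..<m}" using that by auto
    then show ?thesis by (subst gf_word_rec) (simp add: algebra_simps)
  qed
  have "(1 - 2 * fps_X) * gf (word m m v) = (1 - fps_X) * gf (word m m (Suc v))"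
  proof -
    have "gf (word m m v) = 1 + fps_X * (gf (word m m v) + (\<Sum>w\<in>{Suc v..<m}. gf (word m m w)))
        + fps_X * gf (word m m v)"
      using *[of v] step.hyps by (simp add: sum.atLeast_Suc_lessThan[of v m])
    moreover have "gf (word m m (Suc v)) =
        1 + fps_X * (\<Sum>w\<in>{Suc v..<m}. gf (word m m w)) + fps_X * gf (word m m (Suc v))"
      using *[of "Suc v"] step.hyps by simp
    ultimately show ?thesis by algebra
  qed
  also have "\<dots> = (1 - 2 * fps_X) * (bigeom * gf (word m m (Suc v)))"
    using bigeom by algebra
  finally have "gf (word m m v) = bigeom * gf (word m m (Suc v))"
    by (subst (asm) mult_cancel_left) (auto dest: arg_cong[of _ _ "\<lambda>f. f $ 0"] simp: numeral_fps_const)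
  also have "\<dots> = geom * bigeom ^ Suc (m - Suc v)" using step by simp
  finally show ?case using step by (simp add: Suc_diff_Suc)
qed

section \<open>Recursion over ascending prefixes\<close>

definition completions :: "nat list \<Rightarrow> real fps" where
  "completions \<alpha> = gf (\<lambda>\<tau>. valid (\<alpha> @ \<tau>))"

definition descents :: "nat list \<Rightarrow> real fps" where
  "descents \<alpha> = (\<Sum>w<last \<alpha>. gf (word (last \<alpha>) (succ_in \<alpha> w) w))"

text \<open>The contribution of descents below \<open>last \<alpha>\<close> once a strictly larger
  letter is appended: successors are then below the maximum and \<open>gf_word_less\<close>
  applies.\<close>

definition gaps :: "nat list \<Rightarrow> real fps" where
  "gaps \<alpha> = (\<Sum>w<last \<alpha>. geom ^ (Suc (succ_in \<alpha> w) - w))"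

lemma finite_completions: "finite {\<tau>. length \<tau> = n \<and> valid (\<alpha> @ \<tau>)}"
proof -
  have "(@) \<alpha> ` {\<tau>. length \<tau> = n \<and> valid (\<alpha> @ \<tau>)} \<subseteq>
      avoiding_inversion_sequences (length \<alpha> + n) {[1, 0, 2], [2, 1, 0]}"
    by (auto simp: avoiding_inversion_sequences_eq)
  from finite_subset[OF this finite_avoiding_inversion_sequences]
  show ?thesis by (rule finite_imageD) (auto simp: inj_on_def)
qed

text \<open>The next letter is absent, descends and leaves a tail described by
  \<open>valid_descent\<close>, or extends the ascending prefix.\<close>

lemma completions_rec:
  assumes "ascending \<alpha>"
  shows "completions \<alpha> = 1 + fps_X * (descents \<alpha> + (\<Sum>v=last \<alpha>..length \<alpha>. completions (\<alpha> @ [v])))"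
proof -
  have L: "last \<alpha> < length \<alpha>" using assms by (rule ascending_last)
  have "completions \<alpha> = (if valid (\<alpha> @ []) then 1 else 0) +
      fps_X * (\<Sum>v\<in>{..length \<alpha>}. gf (\<lambda>\<tau>. valid (\<alpha> @ v # \<tau>)))"
    unfolding completions_def
  proof (rule gf_Cons)
    show "v \<in> {..length \<alpha>}" if "valid (\<alpha> @ v # \<tau>)" for v \<tau>
      using that by (auto simp: valid_def inversion_sequence_append)
  qed (auto simp: finite_completions)
  also have "{..length \<alpha>} = {..<last \<alpha>} \<union> {last \<alpha>..length \<alpha>}" using L by auto
  also have "(\<Sum>v\<in>\<dots>. gf (\<lambda>\<tau>. valid (\<alpha> @ v # \<tau>))) =
      (\<Sum>v<last \<alpha>. gf (\<lambda>\<tau>. valid (\<alpha> @ v # \<tau>))) + (\<Sum>v=last \<alpha>..length \<alpha>. gf (\<lambda>\<tau>. valid (\<alpha> @ v # \<tau>)))"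
    by (rule sum.union_disjoint) auto
  also have "(\<Sum>v<last \<alpha>. gf (\<lambda>\<tau>. valid (\<alpha> @ v # \<tau>))) = descents \<alpha>"
    unfolding descents_def using assms by (intro sum.cong) (auto simp: valid_descent)
  finally show ?thesis using assms by (simp add: completions_def ascending_valid)
qed

lemma sum_lessThan_add: "(\<Sum>i<m + n. f i) = (\<Sum>i<m. f i) + (\<Sum>i<n. f (m + i :: nat))"
  for f :: "nat \<Rightarrow> 'a::comm_monoid_add"
  by (induction n) (auto simp: add.assoc)

lemma sum_lessThan_rev: "(\<Sum>i<n. f (n - i)) = (\<Sum>i<n. f (Suc i))"
  for f :: "nat \<Rightarrow> 'a::comm_monoid_add"
  using sum.nat_diff_reindex[of "\<lambda>i. f (Suc i)" n] by (simp add: Suc_diff_Suc)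

text \<open>The \<open>d\<close> values from \<open>last \<alpha>\<close> on get the new letter as
  successor and add a geometric sum, summed with \<open>fps_X * geom = geom - 1\<close>.\<close>

lemma gaps_snoc:
  assumes "ascending \<alpha>"
  shows "fps_X * gaps (\<alpha> @ [last \<alpha> + d]) = fps_X * gaps \<alpha> + geom * (geom ^ d - 1)"
proof -
  have s: "sorted \<alpha>" "\<alpha> \<noteq> []" using assms by (auto simp: ascending_def)
  have "gaps (\<alpha> @ [last \<alpha> + d]) = gaps \<alpha> + (\<Sum>i<d. geom ^ Suc (d - i))"
    by (simp add: gaps_def sum_lessThan_add succ_in_snoc s Suc_diff_le)
  also have "\<dots> = gaps \<alpha> + (\<Sum>i<d. geom ^ Suc (Suc i))"
    by (simp only: sum_lessThan_rev[of "\<lambda>i. geom ^ Suc i"])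
  finally have *: "gaps (\<alpha> @ [last \<alpha> + d]) = gaps \<alpha> + (\<Sum>i<d. geom ^ Suc (Suc i))" .
  have "fps_X * (\<Sum>i<d. geom ^ Suc (Suc i)) = geom * (geom ^ d - 1)"
  proof (induction d)
    case (Suc d)
    have "fps_X * (\<Sum>i<Suc d. geom ^ Suc (Suc i)) =
        fps_X * (\<Sum>i<d. geom ^ Suc (Suc i)) + geom * geom ^ d * (fps_X * geom)"
      by (simp add: algebra_simps)
    also have "fps_X * geom = geom - 1" using geom(2) by algebra
    finally show ?case by (simp only: Suc.IH) (simp add: algebra_simps)
  qed simp
  then show ?thesis by (simp add: * distrib_left)
qed

lemma descents_snoc_0:
  assumes "ascending \<alpha>"
  shows "descents (\<alpha> @ [last \<alpha>]) = descents \<alpha>"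
  using assms by (simp add: descents_def succ_in_snoc ascending_def)

text \<open>A strictly larger last letter turns the old descents into gaps, while the
  \<open>d\<close> new values have the maximum itself as successor and are counted by
  \<open>gf_word_eq\<close>.\<close>

lemma descents_snoc:
  assumes "ascending \<alpha>" "d > 0"
  shows "fps_X * descents (\<alpha> @ [last \<alpha> + d]) = fps_X * gaps \<alpha> + (bigeom ^ d - 1)"
proof -
  define L where "L = last \<alpha>"
  have s: "sorted \<alpha>" "\<alpha> \<noteq> []" using assms by (auto simp: ascending_def)
  have "descents (\<alpha> @ [L + d]) =
      (\<Sum>w<L. gf (word (L + d) (succ_in \<alpha> w) w)) + (\<Sum>i<d. gf (word (L + d) (L + d) (L + i)))"
    by (simp add: descents_def sum_lessThan_add succ_in_snoc s L_def)
  also have "(\<Sum>w<L. gf (word (L + d) (succ_in \<alpha> w) w)) = gaps \<alpha>"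
    unfolding gaps_def L_def
  proof (rule sum.cong)
    fix w assume "w \<in> {..<last \<alpha>}"
    then have "w < succ_in \<alpha> w" "succ_in \<alpha> w \<le> last \<alpha>" using succ_in[of \<alpha> w] succ_in_le s by auto
    with assms(2) show "gf (word (last \<alpha> + d) (succ_in \<alpha> w) w) = geom ^ (Suc (succ_in \<alpha> w) - w)"
      by (intro gf_word_less) auto
  qed simp
  also have "(\<Sum>i<d. gf (word (L + d) (L + d) (L + i))) = (\<Sum>i<d. geom * bigeom ^ (d - i))"
    by (simp add: gf_word_eq)
  also have "\<dots> = (\<Sum>i<d. geom * bigeom ^ Suc i)"
    by (simp only: sum_lessThan_rev[of "\<lambda>i. geom * bigeom ^ i"])
  finally have *: "descents (\<alpha> @ [L + d]) = gaps \<alpha> + (\<Sum>i<d. geom * bigeom ^ Suc i)" .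
  have "fps_X * (\<Sum>i<d. geom * bigeom ^ Suc i) = bigeom ^ d - 1"
  proof (induction d)
    case (Suc d)
    have "fps_X * (\<Sum>i<Suc d. geom * bigeom ^ Suc i) =
        fps_X * (\<Sum>i<d. geom * bigeom ^ Suc i) + bigeom ^ d * (fps_X * geom * bigeom)"
      by (simp add: algebra_simps)
    then show ?case by (simp only: Suc.IH bigeom_diff_1) (simp add: algebra_simps)
  qed simp
  then show ?thesis by (simp add: * distrib_left flip: L_def)
qed

section \<open>Solving the recursion in the slack\<close>

text \<open>As \<open>f (Suc e)\<close> occurs on the right, the construction recurses on the
  coefficient index instead of on \<open>e\<close>: \<open>h n e\<close> is coefficient
  \<open>n\<close> of \<open>f e\<close>.\<close>

lemma ascending_recursion_solvable:
  fixes R :: "nat \<Rightarrow> 'a::comm_ring_1 fps"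
  obtains f where "\<And>e. f e = R e + fps_X * (\<Sum>d\<le>e. f (Suc e - d))"
proof -
  define h where "h = rec_nat (\<lambda>e. R e $ 0) (\<lambda>n g e. R e $ Suc n + (\<Sum>d\<le>e. g (Suc e - d)))"
  define f where "f e = Abs_fps (\<lambda>n. h n e)" for e
  have "f e = R e + fps_X * (\<Sum>d\<le>e. f (Suc e - d))" for e
  proof (rule fps_ext)
    fix n show "f e $ n = (R e + fps_X * (\<Sum>d\<le>e. f (Suc e - d))) $ n"
      by (cases n) (simp_all add: f_def h_def fps_sum_nth)
  qed
  then show ?thesis using that by blast
qed

text \<open>The kernel method: the Catalan series \<open>c\<close> is a root of \<open>x t\<^sup>2 - t + 1\<close>, so with the partial
  sums \<open>S e = f 1 + \<dots> + f e\<close> the differences \<open>S (e + 1) - c S e\<close> satisfy a first-order recursion.\<close>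

lemma ascending_recursion_kernel:
  assumes f: "\<And>e. f e = R e + fps_X * (\<Sum>d\<le>e. f (Suc e - d))"
    and V: "\<And>e. V e = catalan * R e + fps_X * catalan * V (Suc e)"
  shows "f 1 = V 1"
proof -
  define S where "S e = (\<Sum>i<e. f (Suc i))" for e
  have S: "(\<Sum>d\<le>e. f (Suc e - d)) = S (Suc e)" for e
    unfolding S_def lessThan_Suc_atMost[symmetric] by (rule sum_lessThan_rev)
  \<comment> \<open>Since \<open>S 0 = 0\<close> and \<open>S 1 = f 1\<close>, the claim is the
    vanishing of \<open>\<Delta> 0\<close>.\<close>
  define \<Delta> where "\<Delta> e = S (Suc e) - catalan * S e - V (Suc e)" for e
  have "\<Delta> e = fps_X * (\<Sum>j\<in>{Suc e}. catalan * \<Delta> j)" for e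
  proof -
    have "S (Suc e) = S e + f (Suc e)" by (simp add: S_def)
    moreover have "f (Suc e) = R (Suc e) + fps_X * S (Suc (Suc e))" by (subst f) (simp only: S)
    ultimately have "\<Delta> e = fps_X * (catalan * \<Delta> (Suc e))"
      unfolding \<Delta>_def using V[of "Suc e"] catalan by algebra
    then show ?thesis by simp
  qed
  then have "\<Delta> 0 = 0"
    using fps_contraction_unique[of UNIV "\<lambda>e. {Suc e}" \<Delta> "\<lambda>_. catalan" 0] by blast
  then show ?thesis by (simp add: \<Delta>_def S_def)
qed

definition gap_weight :: "nat \<Rightarrow> real fps" where
  "gap_weight e = fps_X * (catalan ^ Suc e - geom)"

text \<open>With \<open>e = length \<alpha> - last \<alpha>\<close>, the completions of \<open>\<alpha>\<close> are counted by
  \<open>f e + x geom descents \<alpha> + gap_weight e gaps \<alpha>\<close>. Substituting this ansatz into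
  \<open>completions_rec\<close> produces the recursions for \<open>gap_weight\<close> and \<open>f\<close>, the latter with
  inhomogeneous part \<open>base_weight\<close>.\<close>

definition base_weight :: "nat \<Rightarrow> real fps" where
  "base_weight e = 1 + fps_X * geom * (\<Sum>d\<le>e. bigeom ^ d - 1) +
     geom * (\<Sum>d\<le>e. gap_weight (Suc e - d) * (geom ^ d - 1))"

text \<open>Telescopes, since x c^(k+2) = c^(k+1) - c^k for the Catalan series c.\<close>

lemma catalan_sum: "fps_X * (\<Sum>d\<le>e. catalan ^ Suc (Suc e - d)) = catalan ^ Suc e - 1"
proof (induction e)
  case 0
  show ?case using catalan by (simp add: power2_eq_square)
next
  case (Suc e)
  have "fps_X * (\<Sum>d\<le>Suc e. catalan ^ Suc (Suc (Suc e) - d)) =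
      catalan ^ Suc e * (fps_X * catalan\<^sup>2) + fps_X * (\<Sum>d\<le>e. catalan ^ Suc (Suc e - d))"
    by (subst sum.atMost_Suc_shift) (simp add: algebra_simps power2_eq_square)
  then show ?case by (simp only: catalan Suc.IH) (simp add: algebra_simps)
qed

text \<open>Compares the coefficients of \<open>gaps \<alpha>\<close> in the ansatz; the term with
  \<open>of_nat e\<close> collects the \<open>e\<close> strict ascents, each turning descents into
  gaps.\<close>

lemma gap_weight_rec:
  "gap_weight e = fps_X\<^sup>2 * geom * of_nat e + fps_X * (\<Sum>d\<le>e. gap_weight (Suc e - d))"
proof -
  have "(\<Sum>d\<le>e. gap_weight (Suc e - d)) =
      fps_X * (\<Sum>d\<le>e. catalan ^ Suc (Suc e - d)) - fps_X * of_nat (Suc e) * geom"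
    unfolding gap_weight_def by (simp only: right_diff_distrib sum_subtractf sum_distrib_left) (simp add: mult_ac)
  also have "fps_X * (\<Sum>d\<le>e. catalan ^ Suc (Suc e - d)) = catalan ^ Suc e - 1" by (rule catalan_sum)
  finally have *: "(\<Sum>d\<le>e. gap_weight (Suc e - d)) = catalan ^ Suc e - 1 - fps_X * of_nat (Suc e) * geom" .
  have "geom - fps_X * geom = 1" using geom(2) by (simp add: algebra_simps)
  then have "fps_X * (catalan ^ Suc e - geom) =
      fps_X\<^sup>2 * geom * of_nat e + fps_X * (catalan ^ Suc e - 1 - fps_X * (1 + of_nat e) * geom)"
    by algebra
  then show ?thesis by (simp only: * gap_weight_def[of e] of_nat_Suc)
qed

text \<open>The ansatz satisfies the recursion of \<open>completions_rec\<close>, whose solution is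
  unique by \<open>fps_contraction_unique\<close>.\<close>

lemma completions_eq:
  assumes f: "\<And>e. f e = base_weight e + fps_X * (\<Sum>d\<le>e. f (Suc e - d))" and "ascending \<alpha>"
  defines "F \<equiv> \<lambda>\<alpha>. f (length \<alpha> - last \<alpha>) + fps_X * geom * descents \<alpha> +
    gap_weight (length \<alpha> - last \<alpha>) * gaps \<alpha>"
  shows "completions \<alpha> = F \<alpha>"
proof -
  have F: "F \<alpha> = 1 + fps_X * (descents \<alpha> + (\<Sum>v=last \<alpha>..length \<alpha>. F (\<alpha> @ [v])))"
    if \<alpha>: "ascending \<alpha>" for \<alpha>
  proof -
    define L where "L = last \<alpha>"
    define e where "e = length \<alpha> - L"
    have e: "length \<alpha> = L + e" using ascending_last[OF \<alpha>] by (simp add: L_def e_def)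
    have len: "length (\<alpha> @ [L + d]) - last (\<alpha> @ [L + d]) = Suc e - d" for d by (simp add: e)
    have "(\<Sum>v=L..length \<alpha>. F (\<alpha> @ [v])) = (\<Sum>d\<le>e. F (\<alpha> @ [L + d]))"
      unfolding e by (subst sum.atLeastAtMost_shift_0) (simp_all add: atMost_atLeast0)
    then have "fps_X * (\<Sum>v=L..length \<alpha>. F (\<alpha> @ [v])) =
        fps_X * (\<Sum>d\<le>e. f (Suc e - d)) + fps_X * geom * (\<Sum>d\<le>e. fps_X * descents (\<alpha> @ [L + d])) +
        (\<Sum>d\<le>e. gap_weight (Suc e - d) * (fps_X * gaps (\<alpha> @ [L + d])))"
      unfolding F_def len by (simp add: sum.distrib sum_distrib_left mult_ac distrib_left)
    also have "(\<Sum>d\<le>e. gap_weight (Suc e - d) * (fps_X * gaps (\<alpha> @ [L + d]))) =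
       (\<Sum>d\<le>e. gap_weight (Suc e - d)) * (fps_X * gaps \<alpha>) +
       geom * (\<Sum>d\<le>e. gap_weight (Suc e - d) * (geom ^ d - 1))"
      unfolding L_def gaps_snoc[OF \<alpha>]
      by (simp only: distrib_left sum.distrib sum_distrib_left sum_distrib_right) (simp add: mult_ac)
    also have "(\<Sum>d\<le>e. fps_X * descents (\<alpha> @ [L + d])) =
       fps_X * descents \<alpha> + of_nat e * (fps_X * gaps \<alpha>) + (\<Sum>d\<le>e. bigeom ^ d - 1)"
    proof -
      have "{..e} = insert 0 {1..e}" by auto
      moreover have "(\<Sum>d\<in>{1..e}. fps_X * descents (\<alpha> @ [L + d])) =
          (\<Sum>d\<in>{1..e}. fps_X * gaps \<alpha> + (bigeom ^ d - 1))"
        by (rule sum.cong) (auto simp: descents_snoc \<alpha> L_def)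
      ultimately show ?thesis by (simp add: descents_snoc_0 \<alpha> L_def sum.distrib)
    qed
    finally have *: "fps_X * (\<Sum>v=L..length \<alpha>. F (\<alpha> @ [v])) =
        fps_X * (\<Sum>d\<le>e. f (Suc e - d)) + fps_X * geom *
          (fps_X * descents \<alpha> + of_nat e * (fps_X * gaps \<alpha>) + (\<Sum>d\<le>e. bigeom ^ d - 1)) +
        ((\<Sum>d\<le>e. gap_weight (Suc e - d)) * (fps_X * gaps \<alpha>) +
          geom * (\<Sum>d\<le>e. gap_weight (Suc e - d) * (geom ^ d - 1)))" .
    have "F \<alpha> = base_weight e + fps_X * (\<Sum>d\<le>e. f (Suc e - d)) + fps_X * geom * descents \<alpha> +
        (fps_X\<^sup>2 * geom * of_nat e + fps_X * (\<Sum>d\<le>e. gap_weight (Suc e - d))) * gaps \<alpha>"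
      unfolding F_def L_def[symmetric] e_def[symmetric] by (simp only: f[of e, symmetric] gap_weight_rec[of e, symmetric])
    \<comment> \<open>The relation for \<open>g\<close> merges \<open>x * D\<close> and
      \<open>x * g * (x * D)\<close> into \<open>x * g * D\<close>.\<close>
    moreover have "1 + x * g * B + g * C + x * S + x * g * D + (x\<^sup>2 * g * n + x * T) * Y =
        1 + x * D + (x * S + x * g * (x * D + n * (x * Y) + B) + (T * (x * Y) + g * C))"
      if "g = 1 + x * g" for x g B C D S T Y n :: "real fps"
      using that by algebra
    ultimately show ?thesis
      unfolding L_def[symmetric] distrib_left[of fps_X "descents \<alpha>"] * base_weight_def
      using geom(2) by (simp only: add.assoc)
  qed
  have "completions \<alpha> - F \<alpha> = 0"
  proof (rule fps_contraction_unique[where S = "{\<alpha>. ascending \<alpha>}" and q = "\<lambda>_. 1"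
        and J = "\<lambda>\<alpha>. (\<lambda>v. \<alpha> @ [v]) ` {last \<alpha>..length \<alpha>}" and i = \<alpha>])
    fix \<alpha> assume "\<alpha> \<in> {\<alpha>. ascending \<alpha>}"
    then have \<alpha>: "ascending \<alpha>" by simp
    show "completions \<alpha> - F \<alpha> = fps_X *
        (\<Sum>\<beta>\<in>(\<lambda>v. \<alpha> @ [v]) ` {last \<alpha>..length \<alpha>}. 1 * (completions \<beta> - F \<beta>))"
      by (subst completions_rec[OF \<alpha>], subst F[OF \<alpha>], subst sum.reindex)
        (auto simp: inj_on_def sum_subtractf algebra_simps)
  qed (use \<open>ascending \<alpha>\<close> in \<open>auto intro: ascending_snoc\<close>)
  then show ?thesis by simp
qed


section \<open>Closed form of the inhomogeneous part\<close>

text \<open>A geometric sum in \<open>catalan\<close> and \<open>geom\<close>;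
  \<open>catalan_diff_geom\<close> replaces division by their difference.\<close>

lemma catalan_geom_sum:
  "fps_X\<^sup>2 * catalan * (\<Sum>d\<le>e. catalan ^ Suc (Suc e - d) * geom ^ d) =
     catalan ^ e - geom ^ e + fps_X\<^sup>2 * catalan ^ 3 * catalan ^ e"
proof (induction e)
  case 0
  show ?case by (simp add: power2_eq_square power3_eq_cube mult_ac)
next
  case (Suc e)
  have "(\<Sum>d\<le>Suc e. catalan ^ Suc (Suc (Suc e) - d) * geom ^ d) =
      catalan * (\<Sum>d\<le>e. catalan ^ Suc (Suc e - d) * geom ^ d) + catalan\<^sup>2 * (geom * geom ^ e)"
  proof -
    have "catalan ^ Suc (Suc (Suc e) - d) * geom ^ d = catalan * (catalan ^ Suc (Suc e - d) * geom ^ d)"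
      if "d \<le> e" for d
      using that by (simp add: Suc_diff_le)
    then have "(\<Sum>d\<le>e. catalan ^ Suc (Suc (Suc e) - d) * geom ^ d) =
        catalan * (\<Sum>d\<le>e. catalan ^ Suc (Suc e - d) * geom ^ d)"
      unfolding sum_distrib_left by (intro sum.cong) auto
    then show ?thesis by (simp add: power2_eq_square)
  qed
  then have "fps_X\<^sup>2 * catalan * (\<Sum>d\<le>Suc e. catalan ^ Suc (Suc (Suc e) - d) * geom ^ d) =
      catalan * (fps_X\<^sup>2 * catalan * (\<Sum>d\<le>e. catalan ^ Suc (Suc e - d) * geom ^ d)) +
      (fps_X\<^sup>2 * catalan ^ 3 * geom) * geom ^ e"
    by (simp add: algebra_simps power2_eq_square power3_eq_cube)
  then show ?case
    unfolding Suc.IH catalan_diff_geom[symmetric] by (simp add: algebra_simps)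
qed

lemma geom_sum: "fps_X * geom * (\<Sum>d\<le>e. geom ^ d) = geom * geom ^ e - 1"
proof (induction e)
  case 0
  show ?case using geom(2) by (simp add: algebra_simps)
next
  case (Suc e)
  have "fps_X * geom * (\<Sum>d\<le>Suc e. geom ^ d) =
      fps_X * geom * (\<Sum>d\<le>e. geom ^ d) + (geom - 1) * (geom * geom ^ e)"
  proof -
    have "geom - 1 = fps_X * geom" using geom(2) by algebra
    then show ?thesis by (simp only:) (simp add: algebra_simps)
  qed
  then show ?case by (simp only: Suc.IH) (simp add: algebra_simps)
qed

lemma bigeom_sum: "fps_X * geom * (\<Sum>d\<le>e. bigeom ^ d) = bigeom ^ e - 1 + fps_X * geom"
proof (induction e)
  case (Suc e)
  have "fps_X * geom * (\<Sum>d\<le>Suc e. bigeom ^ d) =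
      fps_X * geom * (\<Sum>d\<le>e. bigeom ^ d) + (fps_X * geom * bigeom) * bigeom ^ e"
    by (simp add: algebra_simps)
  then show ?case by (simp only: Suc.IH bigeom_diff_1) (simp add: algebra_simps)
qed simp

text \<open>The factor \<open>fps_X * catalan\<close> clears the denominator of the mixed sum in
  \<open>catalan_geom_sum\<close>, leaving three powers and terms at most linear in
  \<open>e\<close>.\<close>

lemma base_weight_closed:
  "fps_X * catalan * base_weight e = fps_X * catalan * bigeom ^ e - fps_X\<^sup>2 * catalan * geom * of_nat e +
     geom * ((1 - fps_X * catalan) * catalan ^ e - (1 + fps_X * catalan * geom) * geom ^ e +
       fps_X * catalan * (1 + geom) + fps_X\<^sup>2 * catalan * geom * of_nat e)"
proof -
  define x :: "real fps" where "x = fps_X"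
  define SB where "SB = (\<Sum>d\<le>e. bigeom ^ d)"
  define SG where "SG = (\<Sum>d\<le>e. geom ^ d)"
  define SC where "SC = (\<Sum>d\<le>e. catalan ^ Suc (Suc e - d))"
  define SCG where "SCG = (\<Sum>d\<le>e. catalan ^ Suc (Suc e - d) * geom ^ d)"
  define n :: "real fps" where "n = of_nat e"
  have s1: "(\<Sum>d\<le>e. bigeom ^ d - 1) = SB - (n + 1)"
    by (simp add: sum_subtractf SB_def n_def)
  have s2: "(\<Sum>d\<le>e. gap_weight (Suc e - d) * (geom ^ d - 1)) =
      x * (SCG - SC - geom * SG + geom * (n + 1))"
  proof -
    have "gap_weight (Suc e - d) * (geom ^ d - 1) = x * (catalan ^ Suc (Suc e - d) * geom ^ d
        - catalan ^ Suc (Suc e - d) - geom * geom ^ d + geom)" for d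
      unfolding gap_weight_def x_def by (simp add: algebra_simps del: power_Suc)
    then have "(\<Sum>d\<le>e. gap_weight (Suc e - d) * (geom ^ d - 1)) = x * (\<Sum>d\<le>e.
        catalan ^ Suc (Suc e - d) * geom ^ d - catalan ^ Suc (Suc e - d) - geom * geom ^ d + geom)"
      by (simp only: sum_distrib_left)
    also have "(\<Sum>d\<le>e. catalan ^ Suc (Suc e - d) * geom ^ d - catalan ^ Suc (Suc e - d)
        - geom * geom ^ d + geom) = SCG - SC - geom * SG + geom * (n + 1)"
      unfolding SCG_def SC_def SG_def n_def sum.distrib sum_subtractf sum_distrib_left
      by (simp add: algebra_simps)
    finally show ?thesis .
  qed
  have "x * catalan * base_weight e =
      x * catalan * (1 + x * geom * SB - x * geom * (n + 1)) + geom * (x\<^sup>2 * catalan * SCG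
        - x * catalan * (x * SC) - x * catalan * (x * geom * SG) + x\<^sup>2 * catalan * geom * (n + 1))"
    unfolding base_weight_def s1 s2 x_def by (simp add: algebra_simps power2_eq_square)
  also have "x * geom * SB = bigeom ^ e - 1 + x * geom"
    unfolding SB_def x_def by (rule bigeom_sum)
  also have "x\<^sup>2 * catalan * SCG = catalan ^ e - geom ^ e + x\<^sup>2 * catalan ^ 3 * catalan ^ e"
    unfolding SCG_def x_def by (rule catalan_geom_sum)
  also have "x * SC = catalan * catalan ^ e - 1"
    unfolding SC_def x_def catalan_sum by simp
  also have "x * geom * SG = geom * geom ^ e - 1"
    unfolding SG_def x_def by (rule geom_sum)
  finally have *: "x * catalan * base_weight e =
      x * catalan * (1 + (bigeom ^ e - 1 + x * geom) - x * geom * (n + 1)) +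
      geom * (catalan ^ e - geom ^ e + x\<^sup>2 * catalan ^ 3 * catalan ^ e
        - x * catalan * (catalan * catalan ^ e - 1) - x * catalan * (geom * geom ^ e - 1)
        + x\<^sup>2 * catalan * geom * (n + 1))" .
  have "x * c * (1 + (p - 1 + x * y) - x * y * (n + 1)) +
      y * (q - r + x\<^sup>2 * c ^ 3 * q - x * c * (c * q - 1) - x * c * (y * r - 1) + x\<^sup>2 * c * y * (n + 1)) =
      x * c * p - x\<^sup>2 * c * y * n + y * ((1 - x * c) * q - (1 + x * c * y) * r + x * c * (1 + y)
        + x\<^sup>2 * c * y * n)"
    if "x * c\<^sup>2 = c - 1" "y = 1 + x * y" for c y p q r :: "real fps"
    using that by algebra
  from this[of catalan geom, folded x_def, OF catalan[folded x_def] geom(2)[folded x_def]]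
  show ?thesis unfolding x_def[symmetric] n_def[symmetric] * .
qed

text \<open>The solution of the first-order recursion of the kernel method, obtained by summing
  \<open>catalan * (x catalan)\<^sup>i * base_weight (e + i)\<close> over \<open>i\<close> as geometric series and multiplying
  by \<open>x catalan\<close>.\<close>

definition kernel_sum :: "nat \<Rightarrow> real fps" where
  "kernel_sum e = fps_X * catalan ^ 5 * (1 - 2 * fps_X) * bigeom ^ e +
     geom * inverse (2 - catalan) * catalan ^ e - (1 + fps_X * catalan * geom) * catalan ^ 3 * geom ^ e +
     fps_X * catalan ^ 3 * geom * (1 + geom) + fps_X ^ 3 * geom\<^sup>2 * catalan ^ 3 * (of_nat e + fps_X * catalan\<^sup>2)"

lemma inverse_2_minus_catalan: "inverse (2 - catalan) * (2 - catalan) = 1"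
  by (rule inverse_mult_eq_1) (simp add: catalan_nth_0 numeral_fps_const)

lemma kernel_sum_rec:
  "kernel_sum e = catalan * (fps_X * catalan * base_weight e) + fps_X * catalan * kernel_sum (Suc e)"
proof -
  define x :: "real fps" where "x = fps_X"
  define c where "c = catalan"
  define y where "y = geom"
  define u where "u = bigeom"
  define w where "w = inverse (2 - c)"
  define n :: "real fps" where "n = of_nat e"
  have c: "x * c\<^sup>2 = c - 1" unfolding x_def c_def by (rule catalan)
  have y: "y = 1 + x * y" unfolding x_def y_def by (rule geom(2))
  have u: "(1 - 2 * x) * u = 1 - x" unfolding x_def u_def by (rule bigeom)
  have w: "w * (2 - c) = 1" unfolding w_def c_def by (rule inverse_2_minus_catalan)
  \<comment> \<open>With r = xc, the coefficients come from 1/(1 - ru) = c^3 (1 - 2x), 1/(1 - rc) =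
    1/(2 - c), y/(1 - ry) = c^2 and 1/(1 - r) = c; the linear term uses that the sum over i of (n +
    i) r^i is c (n + x c^2).\<close>
  define A where "A = x * c ^ 5 * (1 - 2 * x)"
  define B where "B = y * w"
  define C where "C = (1 + x * c * y) * c ^ 3"
  define G where "G = x ^ 3 * y\<^sup>2 * c ^ 3"
  define E where "E = x * c ^ 3 * y * (1 + y)"
  have A: "A = c * (x * c) + x * c * A * u"
    unfolding A_def using c u by algebra
  have B: "B = c * y * (1 - x * c) + x * c * B * c"
    unfolding B_def using c w by algebra
  have C: "C = c * y * (1 + x * c * y) + x * c * C * y"
    unfolding C_def using c y by algebra
  have G: "G = c * (x\<^sup>2 * c * y\<^sup>2 - x\<^sup>2 * c * y) + x * c * G"
    unfolding G_def using c y by algebra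
  have E: "E + G * (x * c\<^sup>2) = c * y * (x * c * (1 + y)) + x * c * (E + G * (1 + x * c\<^sup>2))"
    unfolding E_def G_def using c by algebra
  have "A * p + B * q - C * r + E + G * (n + x * c\<^sup>2) =
      c * (x * c * p - x\<^sup>2 * c * y * n + y * ((1 - x * c) * q - (1 + x * c * y) * r +
        x * c * (1 + y) + x\<^sup>2 * c * y * n)) +
      x * c * (A * (u * p) + B * (c * q) - C * (y * r) + E + G * (1 + n + x * c\<^sup>2))" for p q r
  proof -
    have "A * p = (c * (x * c) + x * c * A * u) * p" using A by simp
    moreover have "B * q = (c * y * (1 - x * c) + x * c * B * c) * q" using B by simp
    moreover have "C * r = (c * y * (1 + x * c * y) + x * c * C * y) * r" using C by simp
    moreover have "G * n = (c * (x\<^sup>2 * c * y\<^sup>2 - x\<^sup>2 * c * y) + x * c * G) * n" using G by simp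
    moreover have "A * p + B * q - C * r + E + G * (n + x * c\<^sup>2) =
        A * p + B * q - C * r + G * n + (E + G * (x * c\<^sup>2))" by (simp add: algebra_simps)
    ultimately have "A * p + B * q - C * r + E + G * (n + x * c\<^sup>2) =
        (c * (x * c) + x * c * A * u) * p + (c * y * (1 - x * c) + x * c * B * c) * q
        - (c * y * (1 + x * c * y) + x * c * C * y) * r
        + (c * (x\<^sup>2 * c * y\<^sup>2 - x\<^sup>2 * c * y) + x * c * G) * n
        + (c * y * (x * c * (1 + y)) + x * c * (E + G * (1 + x * c\<^sup>2)))"
      using E by metis
    then show ?thesis by (simp add: algebra_simps power2_eq_square)
  qed
  then show ?thesis
    unfolding kernel_sum_def base_weight_closed power_Suc of_nat_Suc
    unfolding A_def B_def C_def G_def E_def x_def c_def y_def u_def w_def n_def .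
qed

section \<open>The generating function\<close>

text \<open>The first letter is 0, and \<open>[0]\<close> has slack 1 and no values below its last
  letter, so both statistics vanish and \<open>f 1\<close> remains.\<close>

lemma gf_valid: "fps_X * catalan * (gf valid - 1) = fps_X * kernel_sum 1"
proof -
  obtain f where f: "\<And>e. f e = base_weight e + fps_X * (\<Sum>d\<le>e. f (Suc e - d))"
    by (rule ascending_recursion_solvable[of base_weight]) blast
  have "fps_X * catalan * f e = fps_X * catalan * base_weight e +
      fps_X * (\<Sum>d\<le>e. fps_X * catalan * f (Suc e - d))" for e
    by (subst f) (simp add: algebra_simps sum_distrib_left)
  then have *: "fps_X * catalan * f 1 = kernel_sum 1"
    by (rule ascending_recursion_kernel[where f = "\<lambda>e. fps_X * catalan * f e"]) (rule kernel_sum_rec)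
  have "ascending [0]" by (simp add: ascending_def inversion_sequence_def)
  from completions_eq[OF f this] have "completions [0] = f 1"
    by (simp add: descents_def gaps_def)
  moreover have "gf valid = 1 + fps_X * completions [0]"
  proof -
    have "gf valid = (if valid [] then 1 else 0) + fps_X * (\<Sum>v\<in>{0}. gf (\<lambda>\<tau>. valid (v # \<tau>)))"
    proof (rule gf_Cons)
      show "v \<in> {0}" if "valid (v # \<tau>)" for v \<tau>
        using that by (auto simp: valid_def inversion_sequence_def)
    qed (use finite_completions[of _ "[]"] in simp_all)
    moreover have "valid []" by (simp add: valid_def inversion_sequence_def)
    ultimately show ?thesis by (simp add: completions_def)
  qed
  ultimately show ?thesis using * by (simp add: mult_ac)
qed


theorem theorem25:
  shows "let x = fps_X :: real fps;
             s = sqrt_one_minus_4X;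
             F = Abs_fps (\<lambda>n. real (card (avoiding_inversion_sequences n {[1, 0, 2], [2, 1, 0]})))
         in fps_to_fls F =
              fps_to_fls ((4 * x - 1) * (4 * x ^ 4 - 22 * x ^ 3 + 25 * x ^ 2 - 9 * x + 1)
                          - (2 * x - 1) * (x ^ 2 - 5 * x + 1) * (2 * x ^ 2 - 4 * x + 1) * s)
              / fps_to_fls (2 * x ^ 3 * (4 * x - 1) * (x - 1) ^ 2)"
proof -
  define x :: "real fps" where "x = fps_X"
  define F where "F = gf valid"
  define c where "c = catalan"
  define y where "y = geom"
  define u where "u = bigeom"
  define w where "w = inverse (2 - c)"
  define s where "s = sqrt_one_minus_4X"
  define N where "N = (4 * x - 1) * (4 * x ^ 4 - 22 * x ^ 3 + 25 * x ^ 2 - 9 * x + 1)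
    - (2 * x - 1) * (x ^ 2 - 5 * x + 1) * (2 * x ^ 2 - 4 * x + 1) * s"
  define D where "D = 2 * x ^ 3 * (4 * x - 1) * (x - 1) ^ 2"
  have F_eq: "F = Abs_fps (\<lambda>n. real (card (avoiding_inversion_sequences n {[1, 0, 2], [2, 1, 0]})))"
    by (simp add: F_def gf_def avoiding_inversion_sequences_eq)
  have c: "x * c\<^sup>2 = c - 1" unfolding x_def c_def by (rule catalan)
  have y: "y * (1 - x) = 1" unfolding x_def y_def by (rule geom(1))
  have u: "(1 - 2 * x) * u = 1 - x" unfolding x_def u_def by (rule bigeom)
  have w: "w * (2 - c) = 1" unfolding w_def c_def by (rule inverse_2_minus_catalan)
  have s: "s = 1 - 2 * x * c" unfolding s_def x_def c_def by (rule sqrt_eq_catalan)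
  have x0: "x \<noteq> 0" by (simp add: x_def)
  have c0: "c \<noteq> 0" using catalan_nth_0 by (auto simp: c_def)
  have "x * (c * (F - 1)) = x * (x * c ^ 5 * ((1 - 2 * x) * u) + y * w * c - (1 + x * c * y) * c ^ 3 * y
      + x * c ^ 3 * y * (1 + y) + x ^ 3 * y\<^sup>2 * c ^ 3 * (1 + x * c\<^sup>2))"
    using gf_valid unfolding kernel_sum_def
    unfolding x_def c_def y_def u_def w_def F_def by (simp add: mult_ac)
  then have "c * (F - 1) = x * c ^ 5 * (1 - x) + y * w * c - (1 + x * c * y) * c ^ 3 * y
      + x * c ^ 3 * y * (1 + y) + x ^ 3 * y\<^sup>2 * c ^ 3 * (1 + x * c\<^sup>2)"
    unfolding u using x0 by simp
  then have "c * F * (1 - x)\<^sup>2 = c * (1 - x)\<^sup>2 + x * c ^ 5 * (1 - x) ^ 3 + (1 - x) * w * c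
      - (1 - x + x * c) * c ^ 3 + x * c ^ 3 * (2 - x) + x ^ 3 * c ^ 3 * (1 + x * c\<^sup>2)"
    using y by algebra
  \<comment> \<open>As c times the square root is 2 - c, squaring gives c^2 (1 - 4x) = (2 - c)^2,
    which removes \<open>w\<close>.\<close>
  moreover have "c\<^sup>2 * ((1 - 4 * x) * w) = 2 - c" using c w by algebra
  ultimately have "c\<^sup>2 * (1 - 4 * x) * (F * (1 - x)\<^sup>2) = (1 - x) * (2 - c) + c * (1 - 4 * x) *
      (c * (1 - x)\<^sup>2 + x * c ^ 5 * (1 - x) ^ 3 - (1 - x + x * c) * c ^ 3 + x * c ^ 3 * (2 - x)
        + x ^ 3 * c ^ 3 * (1 + x * c\<^sup>2))" by algebra
  \<comment> \<open>Inserting s = 1 - 2xc leaves a polynomial identity modulo xc^2 = c - 1; the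
    factor c^2 stems from clearing \<open>w\<close>.\<close>
  then have "c\<^sup>2 * (F * D) = c\<^sup>2 * N"
    unfolding D_def N_def s using c by algebra
  then have "F * D = N" using c0 by simp
  moreover have "D \<noteq> 0"
  proof -
    have "(4 * x - 1) $ 0 \<noteq> 0" "(x - 1) $ 0 \<noteq> 0" by (simp_all add: x_def numeral_fps_const)
    then have "4 * x - 1 \<noteq> 0" "x - 1 \<noteq> 0" by (metis fps_zero_nth)+
    with x0 show ?thesis by (simp add: D_def)
  qed
  ultimately have "fps_to_fls F = fps_to_fls N / fps_to_fls D"
    by (simp add: eq_divide_eq flip: fls_times_fps_to_fls)
  then show ?thesis unfolding Let_def F_eq N_def D_def s_def x_def .
qed

end
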